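(* If $u(x)$ satisfies the $q$-Airy equation $$u(xq^2)+x\,u(xq)-u(x)=0,$$ then $v(x)=\theta_q(-q^2x)\,u(1/x)$ (in particular $v(x)=\theta_q(-q^2x)\,\mathrm{Ai}_q(1/x)$) satisfies $$-q^5x^2\,v(xq^2)-v(xq)+v(x)=0,$$ and this last equation is solved by $\mathrm{A}_{q^2}(-q^3x^2)$.
   Context: Fix $q\in\mathbb{C}$ with $0<|q|<1$. The theta function is $\theta_q(x)=\sum_{n\in\mathbb{Z}}q^{n(n-1)/2}x^n$, which satisfies $x\theta_q(qx)=\theta_q(x)$. With $(a;q)_n=\prod_{k=0}^{n-1}(1-aq^k)$, the $q$-Airy function and the Ramanujan function are $$\mathrm{Ai}_q(x)={}_1\varphi_1(0;-q;q,-x)=\sum_{n\ge0}\frac{q^{n(n-1)/2}x^n}{(-q;q)_n(q;q)_n},\qquad \mathrm{A}_q(x)={}_0\varphi_1(-;0;q,-qx)=\sum_{n\ge0}\frac{q^{n^2}(-x)^n}{(q;q)_n};$$ $\mathrm{Ai}_q$ satisfies $u(xq^2)+xu(xq)-u(x)=0$ and $\mathrm{A}_q$ satisfies $qx\,u(xq^2)-u(xq)+u(x)=0$. The function $\mathrm{A}_{q^2}$ is obtained from $\mathrm{A}_q$ by replacing $q$ with $q^2$. *)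

theory Defs
  imports "HOL-Analysis.Analysis"
begin

definition q_pochhammer :: "complex \<Rightarrow> complex \<Rightarrow> nat \<Rightarrow> complex" where
  "q_pochhammer a q n = (\<Prod>k<n. 1 - a * q ^ k)"

text \<open>The product \<open>n * (n - 1)\<close> is always even, so the integer division in the exponents
  below is exact; for \<open>n = 0\<close> in \<^typ>\<open>nat\<close> the truncated subtraction is harmless.\<close>

definition q_theta :: "complex \<Rightarrow> complex \<Rightarrow> complex" where
  "q_theta q x = (\<Sum>\<^sub>\<infinity>n::int\<in>UNIV. q powi (n * (n - 1) div 2) * x powi n)"

definition q_Airy :: "complex \<Rightarrow> complex \<Rightarrow> complex" where
  "q_Airy q x =
     (\<Sum>n::nat. q ^ (n * (n - 1) div 2) * x ^ n / (q_pochhammer (- q) q n * q_pochhammer q q n))"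

definition Ramanujan_A :: "complex \<Rightarrow> complex \<Rightarrow> complex" where
  "Ramanujan_A q x = (\<Sum>n::nat. q ^ (n\<^sup>2) * (- x) ^ n / q_pochhammer q q n)"

text \<open>A function on \<open>D\<close> solves a \<open>q\<close>-difference equation if the equation holds at every point
  where all function values it mentions are taken inside \<open>D\<close>. Thus \<open>D\<close> can be the punctured
  plane, the complement of the poles of a meromorphic solution, or a neighbourhood of \<open>0\<close>
  or \<open>\<infinity>\<close>.\<close>

definition solves_q_Airy_on :: "complex \<Rightarrow> complex set \<Rightarrow> (complex \<Rightarrow> complex) \<Rightarrow> bool" where
  "solves_q_Airy_on q D u \<longleftrightarrow>
     (\<forall>x. x \<in> D \<and> x * q \<in> D \<and> x * q\<^sup>2 \<in> D \<longrightarrow>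
       u (x * q\<^sup>2) + x * u (x * q) - u x = 0)"

definition solves_transformed_q_Airy_on ::
    "complex \<Rightarrow> complex set \<Rightarrow> (complex \<Rightarrow> complex) \<Rightarrow> bool" where
  "solves_transformed_q_Airy_on q D v \<longleftrightarrow>
     (\<forall>x. x \<in> D \<and> x * q \<in> D \<and> x * q\<^sup>2 \<in> D \<longrightarrow>
       - (q ^ 5) * x\<^sup>2 * v (x * q\<^sup>2) - v (x * q) + v x = 0)"

end

theory Submission
  imports Defs
begin

text \<open>The functional equation \<open>x \<theta>(q x) = \<theta>(x)\<close> makes the theta factor of \<open>v\<close> contribute
  \<open>-1/(q\<^sup>2 x)\<close> and \<open>1/(q\<^sup>5 x\<^sup>2)\<close> at \<open>x q\<close> and \<open>x q\<^sup>2\<close>, so the equation for \<open>v\<close> at \<open>x\<close> is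
  \<open>\<theta>(-q\<^sup>2 x)\<close> times the \<open>q\<close>-Airy equation for \<open>u\<close> at \<open>1/(x q\<^sup>2)\<close>. Both \<open>Ai\<^sub>q(z)\<close> and
  \<open>A\<close> in base \<open>q\<^sup>2\<close> at \<open>-q\<^sup>3 z\<close> are power series whose coefficients satisfy
  \<open>(1 - p\<^sup>n\<^sup>+\<^sup>1) a\<^sub>n\<^sub>+\<^sub>1 = c \<beta>\<^sup>n a\<^sub>n\<close> with \<open>p = q\<^sup>2\<close>, which is equivalent to
  \<open>f(z) - f(p z) = c z f(\<beta> z)\<close>.\<close>

lemma power_neq_1_of_norm_less_1:
  fixes p :: complex
  assumes "norm p < 1"
  shows "p ^ Suc n \<noteq> 1"
proof
  assume "p ^ Suc n = 1"
  then have "norm p ^ Suc n = 1"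
    by (metis norm_one norm_power)
  then show False
    using assms power_less_one_iff[of "norm p" "Suc n"] by simp
qed

text \<open>Consecutive terms have ratio \<open>b n * z\<close>, which tends to 0 for every fixed
  \<open>z\<close>, so the radius of convergence is infinite and the equations below hold on the
  whole plane.\<close>

lemma summable_powser_if_ratio_tendsto_0:
  fixes a b :: "nat \<Rightarrow> complex"
  assumes rec: "\<And>n. a (Suc n) = b n * a n" and b: "b \<longlonglongrightarrow> 0"
  shows "summable (\<lambda>n. a n * z ^ n)"
proof -
  have "(\<lambda>n. norm (b n * z)) \<longlonglongrightarrow> 0"
    using tendsto_norm[OF tendsto_mult_right[OF b, of z]] by simp
  then have "eventually (\<lambda>n. norm (b n * z) < 1 / 2) sequentially"
    by (rule order_tendstoD) simp
  then obtain N where N: "\<And>n. n \<ge> N \<Longrightarrow> norm (b n * z) < 1 / 2"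
    by (auto simp: eventually_sequentially)
  show ?thesis
  proof (rule summable_ratio_test)
    fix n assume "N \<le> n"
    have "norm (a (Suc n) * z ^ Suc n) = norm (b n * z) * norm (a n * z ^ n)"
      by (simp add: rec norm_mult)
    also have "\<dots> \<le> 1 / 2 * norm (a n * z ^ n)"
      using N[OF \<open>N \<le> n\<close>] by (intro mult_right_mono) auto
    finally show "norm (a (Suc n) * z ^ Suc n) \<le> 1 / 2 * norm (a n * z ^ n)" .
  qed simp
qed

lemma powser_q_difference_equation:
  fixes a :: "nat \<Rightarrow> complex" and p \<beta> c z :: complex
  defines "f \<equiv> \<lambda>z. \<Sum>n. a n * z ^ n"
  assumes p: "norm p < 1" and \<beta>: "norm \<beta> < 1"
    and rec: "\<And>n. (1 - p ^ Suc n) * a (Suc n) = c * \<beta> ^ n * a n"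
  shows "f z - f (p * z) = c * z * f (\<beta> * z)"
proof -
  have "a (Suc n) = c * \<beta> ^ n / (1 - p ^ Suc n) * a n" for n
    using rec[of n] power_neq_1_of_norm_less_1[OF p, of n] by (simp add: divide_simps mult_ac)
  \<comment> \<open>The numerator tends to 0 because \<open>norm \<beta> < 1\<close>, while the
    denominator tends to 1.\<close>
  moreover have "(\<lambda>n. c * \<beta> ^ n / (1 - p ^ Suc n)) \<longlonglongrightarrow> c * 0 / (1 - 0)"
    by (intro tendsto_intros LIMSEQ_power_zero \<beta> LIMSEQ_Suc[OF LIMSEQ_power_zero[OF p]]) simp
  ultimately have summ: "summable (\<lambda>n. a n * z ^ n)" for z
    by (intro summable_powser_if_ratio_tendsto_0[where b = "\<lambda>n. c * \<beta> ^ n / (1 - p ^ Suc n)"]) auto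
  have "f z - f (p * z) = (\<Sum>n. a n * z ^ n - a n * (p * z) ^ n)"
    unfolding f_def by (rule suminf_diff[OF summ summ])
  \<comment> \<open>The term of index 0 is \<open>a 0 - a 0 = 0\<close>, so the sum may start at
    index 1.\<close>
  also have "\<dots> = (\<Sum>n. a (Suc n) * z ^ Suc n - a (Suc n) * (p * z) ^ Suc n)"
    using suminf_split_head[OF summable_diff[OF summ[of z] summ[of "p * z"]]] by simp
  also have "\<dots> = (\<Sum>n. c * z * (a n * (\<beta> * z) ^ n))"
  proof (rule suminf_cong)
    fix n
    have "a (Suc n) * z ^ Suc n - a (Suc n) * (p * z) ^ Suc n
        = ((1 - p ^ Suc n) * a (Suc n)) * z ^ Suc n"
      by (simp add: power_mult_distrib algebra_simps)
    also have "\<dots> = c * z * (a n * (\<beta> * z) ^ n)"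
      unfolding rec by (simp add: power_mult_distrib)
    finally show "a (Suc n) * z ^ Suc n - a (Suc n) * (p * z) ^ Suc n
        = c * z * (a n * (\<beta> * z) ^ n)" .
  qed
  also have "\<dots> = c * z * f (\<beta> * z)"
    unfolding f_def by (rule suminf_mult[OF summ])
  finally show ?thesis .
qed

lemma q_pochhammer_Suc: "q_pochhammer a q (Suc n) = q_pochhammer a q n * (1 - a * q ^ n)"
  by (simp add: q_pochhammer_def)

lemma q_pochhammer_self_nonzero:
  assumes "norm q < 1"
  shows "q_pochhammer q q n \<noteq> 0"
  using power_neq_1_of_norm_less_1[OF assms] by (simp add: q_pochhammer_def)

text \<open>A difference of squares in each factor. For \<open>a = q\<close> it turns the
  denominator of \<open>q_Airy\<close> into the one of \<open>Ramanujan_A\<close> in base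
  \<open>q\<^sup>2\<close>.\<close>

lemma q_pochhammer_neg_mult:
  "q_pochhammer (- a) q n * q_pochhammer a q n = q_pochhammer (a\<^sup>2) (q\<^sup>2) n"
proof -
  have "(1 - (- a) * q ^ k) * (1 - a * q ^ k) = 1 - a\<^sup>2 * (q\<^sup>2) ^ k" for k
    by (simp add: algebra_simps power2_eq_square power_mult_distrib)
  then show ?thesis
    by (simp add: q_pochhammer_def flip: prod.distrib)
qed

lemma q_Airy_equation:
  assumes "norm q < 1"
  shows "q_Airy q (x * q\<^sup>2) + x * q_Airy q (x * q) - q_Airy q x = 0"
proof -
  define a where "a n = q ^ (n * (n - 1) div 2) / q_pochhammer (q\<^sup>2) (q\<^sup>2) n" for n
  have p: "norm (q\<^sup>2) < 1"
    using assms by (simp add: norm_power abs_square_less_1)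
  have airy: "q_Airy q z = (\<Sum>n. a n * z ^ n)" for z
    by (simp add: q_Airy_def a_def q_pochhammer_neg_mult)
  have rec: "(1 - (q\<^sup>2) ^ Suc n) * a (Suc n) = 1 * q ^ n * a n" for n
  proof -
    \<comment> \<open>The case \<open>n = 0\<close> is separate because of the truncated
      \<open>n - 1\<close>.\<close>
    have "Suc n * (Suc n - 1) div 2 = n + n * (n - 1) div 2"
      by (cases n) simp_all
    then show ?thesis
      using q_pochhammer_self_nonzero[OF p, of n] power_neq_1_of_norm_less_1[OF p, of n]
      by (simp add: a_def q_pochhammer_Suc power_add field_simps)
  qed
  show ?thesis
    using powser_q_difference_equation[OF p assms rec, of x]
    by (simp add: airy mult.commute diff_eq_eq add.commute)
qed

lemma Ramanujan_A_transformed_equation: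
  assumes "norm q < 1"
  defines "v \<equiv> \<lambda>x. Ramanujan_A (q\<^sup>2) (- (q ^ 3) * x\<^sup>2)"
  shows "- (q ^ 5) * x\<^sup>2 * v (x * q\<^sup>2) - v (x * q) + v x = 0"
proof -
  \<comment> \<open>The sign in the argument cancels the one in \<open>(- x) ^ n\<close>, which
    leaves a power series in \<open>x\<^sup>2\<close> with these coefficients.\<close>
  define a where "a n = (q\<^sup>2) ^ (n\<^sup>2) * (q ^ 3) ^ n / q_pochhammer (q\<^sup>2) (q\<^sup>2) n" for n
  have p: "norm (q\<^sup>2) < 1" and \<beta>: "norm (q ^ 4) < 1"
    using assms by (simp_all add: norm_power power_less_one_iff)
  have v: "v z = (\<Sum>n. a n * (z\<^sup>2) ^ n)" for z
    by (simp add: v_def Ramanujan_A_def a_def power_mult_distrib mult.assoc)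
  have rec: "(1 - (q\<^sup>2) ^ Suc n) * a (Suc n) = q ^ 5 * (q ^ 4) ^ n * a n" for n
  proof -
    \<comment> \<open>In exponents: 2(n+1)^2 + 3(n+1) = (2n^2 + 3n) + 4n + 5, hence c = q^5 and
      \<beta> = q^4.\<close>
    have "(q\<^sup>2) ^ ((Suc n)\<^sup>2) * (q ^ 3) ^ Suc n
        = q ^ 5 * (q ^ 4) ^ n * ((q\<^sup>2) ^ (n\<^sup>2) * (q ^ 3) ^ n)"
      by (simp add: power2_eq_square algebra_simps flip: power_mult power_add power_Suc power_Suc2)
    then show ?thesis
      using q_pochhammer_self_nonzero[OF p, of n] power_neq_1_of_norm_less_1[OF p, of n]
      by (simp add: a_def q_pochhammer_Suc divide_simps mult_ac)
  qed
  \<comment> \<open>At z = x^2 the points p z and \<beta> z are the squares of \<open>x * q\<close>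
    and \<open>x * q\<^sup>2\<close>.\<close>
  show ?thesis
    using powser_q_difference_equation[OF p \<beta> rec, of "x\<^sup>2"]
    by (simp add: v power_mult_distrib mult_ac diff_eq_eq flip: power_mult)
qed

text \<open>If the series diverges, \<open>infsum\<close> is \<open>0\<close> on both sides.\<close>

lemma q_theta_shift:
  assumes "q \<noteq> 0" "x \<noteq> 0"
  shows "x * q_theta q (q * x) = q_theta q x"
proof -
  define t where "t n = q powi (n * (n - 1) div 2) * x powi n" for n :: int
  have "x * (q powi (n * (n - 1) div 2) * (q * x) powi n) = t (n + 1)" for n
  proof -
    \<comment> \<open>Splitting off the multiple \<open>n * 2\<close> lets \<open>div\<close> be
      evaluated without using that \<open>n * (n - 1)\<close> is even.\<close>
    have "(n + 1) * (n + 1 - 1) = n * (n - 1) + n * 2"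
      by (simp add: algebra_simps)
    then have "(n + 1) * (n + 1 - 1) div 2 = n * (n - 1) div 2 + n"
      by simp
    then show ?thesis
      using assms by (simp add: t_def power_int_add power_int_mult_distrib)
  qed
  then have "x * q_theta q (q * x) = (\<Sum>\<^sub>\<infinity>n\<in>UNIV. t (n + 1))"
    by (simp add: q_theta_def flip: infsum_cmult_right')
  also have "\<dots> = (\<Sum>\<^sub>\<infinity>n\<in>UNIV. t n)"
    by (rule infsum_reindex_bij_betw) (rule bij_betwI[where g = "\<lambda>n. n - 1"], auto)
  finally show ?thesis
    by (simp add: q_theta_def t_def)
qed

lemma q_theta_transform:
  assumes q: "q \<noteq> 0" and x: "x \<noteq> 0"
    and eq: "u (1 / x) + 1 / (x * q\<^sup>2) * u (1 / (x * q)) - u (1 / (x * q\<^sup>2)) = 0"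
  defines "v \<equiv> \<lambda>x. q_theta q (- (q\<^sup>2) * x) * u (1 / x)"
  shows "- (q ^ 5) * x\<^sup>2 * v (x * q\<^sup>2) - v (x * q) + v x = 0"
proof -
  define T where "T x = q_theta q (- (q\<^sup>2) * x)" for x
  have T: "T y = - (q\<^sup>2) * y * T (y * q)" if "y \<noteq> 0" for y
    using q_theta_shift[of q "- (q\<^sup>2) * y"] q that by (simp add: T_def mult_ac)
  have T1: "T x = - (q\<^sup>2) * x * T (x * q)"
    by (rule T[OF x])
  have "T (x * q) = - (q\<^sup>2) * (x * q) * T (x * q * q)"
    using q x by (intro T) simp
  \<comment> \<open>Two shifts multiply to (-q^2 x)(-q^3 x) = q^5 x^2, the coefficient in the
    transformed equation.\<close>
  then have T2: "T x = q ^ 5 * x\<^sup>2 * T (x * q\<^sup>2)"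
    unfolding T1 by (simp add: eval_nat_numeral mult_ac)
  have T1': "T (x * q) = - (1 / (x * q\<^sup>2)) * T x"
    unfolding T1 using q x by (simp add: field_simps)
  have "- (q ^ 5) * x\<^sup>2 * v (x * q\<^sup>2) - v (x * q) + v x
      = - (q ^ 5 * x\<^sup>2 * T (x * q\<^sup>2)) * u (1 / (x * q\<^sup>2)) - T (x * q) * u (1 / (x * q)) + T x * u (1 / x)"
    by (simp add: v_def T_def)
  also have "\<dots> = T x * (u (1 / x) + 1 / (x * q\<^sup>2) * u (1 / (x * q)) - u (1 / (x * q\<^sup>2)))"
    unfolding T2[symmetric] T1' by (simp add: algebra_simps)
  finally show ?thesis
    unfolding eq by simp
qed

lemma solves_q_Airy_on_transform:
  assumes q: "q \<noteq> 0" and u: "solves_q_Airy_on q D u"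
  shows "solves_transformed_q_Airy_on q {x. x \<noteq> 0 \<and> 1 / x \<in> D}
           (\<lambda>x. q_theta q (- (q\<^sup>2) * x) * u (1 / x))"
  unfolding solves_transformed_q_Airy_on_def
proof (intro allI impI)
  fix x
  assume "x \<in> {x. x \<noteq> 0 \<and> 1 / x \<in> D} \<and> x * q \<in> {x. x \<noteq> 0 \<and> 1 / x \<in> D} \<and>
    x * q\<^sup>2 \<in> {x. x \<noteq> 0 \<and> 1 / x \<in> D}"
  then have x: "x \<noteq> 0" and D: "1 / x \<in> D" "1 / (x * q) \<in> D" "1 / (x * q\<^sup>2) \<in> D"
    by auto
  \<comment> \<open>Inversion reverses the order of the three points, so the equation for
    \<open>u\<close> is taken at the image of \<open>x * q\<^sup>2\<close>.\<close>
  have shift: "1 / (x * q\<^sup>2) * q = 1 / (x * q)" "1 / (x * q\<^sup>2) * q\<^sup>2 = 1 / x"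
    using q x by (simp_all add: power2_eq_square)
  have "u (1 / x) + 1 / (x * q\<^sup>2) * u (1 / (x * q)) - u (1 / (x * q\<^sup>2)) = 0"
    using u[unfolded solves_q_Airy_on_def, rule_format, of "1 / (x * q\<^sup>2)"] D
    unfolding shift by blast
  from q_theta_transform[of q x u, OF q x this]
  show "- (q ^ 5) * x\<^sup>2 * (q_theta q (- (q\<^sup>2) * (x * q\<^sup>2)) * u (1 / (x * q\<^sup>2)))
      - q_theta q (- (q\<^sup>2) * (x * q)) * u (1 / (x * q)) + q_theta q (- (q\<^sup>2) * x) * u (1 / x) = 0" .
qed

theorem lemma3p3:
  fixes q :: complex
  assumes "0 < norm q" and "norm q < 1"
  shows "(\<forall>(D :: complex set) (u :: complex \<Rightarrow> complex).
            solves_q_Airy_on q D u \<longrightarrow>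
            solves_transformed_q_Airy_on q {x. x \<noteq> 0 \<and> 1 / x \<in> D}
              (\<lambda>x. q_theta q (- (q\<^sup>2) * x) * u (1 / x)))
       \<and> solves_transformed_q_Airy_on q (- {0})
            (\<lambda>x. q_theta q (- (q\<^sup>2) * x) * q_Airy q (1 / x))
       \<and> solves_transformed_q_Airy_on q UNIV
            (\<lambda>x. Ramanujan_A (q\<^sup>2) (- (q ^ 3) * x\<^sup>2))"
proof (intro conjI allI impI)
  have q: "q \<noteq> 0"
    using assms(1) by simp
  show "solves_transformed_q_Airy_on q {x. x \<noteq> 0 \<and> 1 / x \<in> D}
          (\<lambda>x. q_theta q (- (q\<^sup>2) * x) * u (1 / x))" if "solves_q_Airy_on q D u" for D u
    using solves_q_Airy_on_transform[OF q that] .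
  have "solves_q_Airy_on q UNIV (q_Airy q)"
    using q_Airy_equation[OF assms(2)] by (simp add: solves_q_Airy_on_def)
  moreover have "{x :: complex. x \<noteq> 0 \<and> 1 / x \<in> UNIV} = - {0}"
    by auto
  ultimately show "solves_transformed_q_Airy_on q (- {0})
      (\<lambda>x. q_theta q (- (q\<^sup>2) * x) * q_Airy q (1 / x))"
    using solves_q_Airy_on_transform[OF q] by metis
  show "solves_transformed_q_Airy_on q UNIV (\<lambda>x. Ramanujan_A (q\<^sup>2) (- (q ^ 3) * x\<^sup>2))"
    unfolding solves_transformed_q_Airy_on_def
    using Ramanujan_A_transformed_equation[OF assms(2)] by blast
qed

end
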